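(* Let $\mathcal{H}$ be a complex Hilbert space, let $A\in\mathcal{B}(\mathcal{H})$ be positive (semi-definite), let $\mathbb{A}=\begin{pmatrix}A&0\\0&A\end{pmatrix}$, and let $\mathbb{T}=\begin{pmatrix}P&Q\\R&S\end{pmatrix}$ with $P,Q,R,S\in\mathcal{B}_{A}(\mathcal{H})$. Then $$\omega_{\mathbb{A}}(\mathbb{T})\le\frac12\Big(\omega_A(P)+\omega_A(S)\Big)+\frac14\Big(\|I+PP^{\sharp_A}+QQ^{\sharp_A}\|_A+\|I+RR^{\sharp_A}+SS^{\sharp_A}\|_A\Big).$$
   Context: $\mathcal{B}(\mathcal{H})$ is the algebra of bounded linear operators on $\mathcal{H}$, and $I$ is the identity operator. The positive semi-definite operator $A$ induces the semi-inner product $\langle x\mid y\rangle_A=\langle Ax\mid y\rangle$ and the seminorm $\|x\|_A=\langle x\mid x\rangle_A^{1/2}=\|A^{1/2}x\|$. An operator $T\in\mathcal{B}(\mathcal{H})$ is $A$-bounded if there is $\lambda>0$ with $\|Tx\|_A\le\lambda\|x\|_A$ for all $x\in\mathcal{H}$; then $\|T\|_A=\sup\{\|Tx\|_A : x\in\mathcal{H},\ \|x\|_A=1\}$. The $A$-numerical radius is $\omega_A(T)=\sup\{|\langle Tx\mid x\rangle_A| : x\in\mathcal{H},\ \|x\|_A=1\}$. $\mathcal{B}_A(\mathcal{H})$ is the set of $T\in\mathcal{B}(\mathcal{H})$ with $\mathcal{R}(T^*A)\subseteq\mathcal{R}(A)$ ($\mathcal{R}$ denotes range), equivalently those admitting an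 $A$-adjoint, i.e. a bounded $X$ with $AX=T^*A$; all such $T$ are $A$-bounded. For $T\in\mathcal{B}_A(\mathcal{H})$, $T^{\sharp_A}$ is the unique bounded solution $X$ of $AX=T^*A$ with $\mathcal{R}(X)\subseteq\overline{\mathcal{R}(A)}$. The operator $\mathbb{A}$ is a positive operator on $\mathcal{H}\oplus\mathcal{H}$, with $\langle x,y\rangle_{\mathbb{A}}=\langle x_1\mid y_1\rangle_A+\langle x_2\mid y_2\rangle_A$ for $x=(x_1,x_2)$, $y=(y_1,y_2)$; $\|\cdot\|_{\mathbb{A}}$ and $\omega_{\mathbb{A}}$ are defined in the same way with $(\mathcal{H}\oplus\mathcal{H},\mathbb{A})$ in place of $(\mathcal{H},A)$. A $2\times2$ matrix of operators on $\mathcal{H}$ denotes the corresponding operator on $\mathcal{H}\oplus\mathcal{H}$. *)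

theory Defs
  imports "HOL-Analysis.Analysis"
begin

text \<open>Complex inner product spaces, with the inner product linear in its first argument. The
  underlying real inner product is the real part of the complex one; positive definiteness and
  the relation to the norm are therefore inherited from \<^class>\<open>real_inner\<close>.\<close>

class complex_inner = real_inner +
  fixes scaleC :: "complex \<Rightarrow> 'a \<Rightarrow> 'a"  (infixr \<open>*\<^sub>C\<close> 75)
    and cinner :: "'a \<Rightarrow> 'a \<Rightarrow> complex"
  assumes scaleC_add_right: "c *\<^sub>C (x + y) = c *\<^sub>C x + c *\<^sub>C y"
    and scaleC_add_left: "(c + d) *\<^sub>C x = c *\<^sub>C x + d *\<^sub>C x"
    and scaleC_scaleC: "c *\<^sub>C d *\<^sub>C x = (c * d) *\<^sub>C x"
    and scaleC_of_real: "complex_of_real r *\<^sub>C x = r *\<^sub>R x"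
    and cinner_commute: "cinner x y = cnj (cinner y x)"
    and cinner_add_left: "cinner (x + y) z = cinner x z + cinner y z"
    and cinner_scaleC_left: "cinner (c *\<^sub>C x) y = c * cinner x y"
    and Re_cinner: "Re (cinner x y) = inner x y"

class chilbert_space = complex_inner + complete_space

instantiation complex :: chilbert_space
begin

definition scaleC_complex :: "complex \<Rightarrow> complex \<Rightarrow> complex"
  where "scaleC_complex c x = c * x"

definition cinner_complex :: "complex \<Rightarrow> complex \<Rightarrow> complex"
  where "cinner_complex x y = x * cnj y"

instance
  by standard
    (auto simp: scaleC_complex_def cinner_complex_def inner_complex_def algebra_simps
      scaleR_conv_of_real)

end

instantiation prod :: (complex_inner, complex_inner) complex_inner
begin

definition scaleC_prod :: "complex \<Rightarrow> 'a \<times> 'b \<Rightarrow> 'a \<times> 'b"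
  where "scaleC_prod c x = (c *\<^sub>C fst x, c *\<^sub>C snd x)"

definition cinner_prod :: "'a \<times> 'b \<Rightarrow> 'a \<times> 'b \<Rightarrow> complex"
  where "cinner_prod x y = cinner (fst x) (fst y) + cinner (snd x) (snd y)"

instance
proof
  fix x y :: "'a \<times> 'b"
  show "cinner x y = cnj (cinner y x)"
    unfolding cinner_prod_def complex_cnj_add
    by (metis cinner_commute)
qed (auto simp: scaleC_prod_def cinner_prod_def inner_prod_def scaleC_add_right scaleC_add_left
    scaleC_scaleC scaleC_of_real scaleR_prod_def cinner_add_left cinner_scaleC_left Re_cinner
    algebra_simps)

end

instance prod :: (chilbert_space, chilbert_space) chilbert_space ..

definition bounded_clinear :: "('a::complex_inner \<Rightarrow> 'b::complex_inner) \<Rightarrow> bool"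
  where "bounded_clinear T \<longleftrightarrow> bounded_linear T \<and> (\<forall>c x. T (c *\<^sub>C x) = c *\<^sub>C T x)"

definition positive_op :: "('a::complex_inner \<Rightarrow> 'a) \<Rightarrow> bool"
  where "positive_op A \<longleftrightarrow> bounded_clinear A \<and> (\<forall>x. cinner (A x) x \<in> \<real>\<^sub>\<ge>\<^sub>0)"

definition cadjoint :: "('a::chilbert_space \<Rightarrow> 'a) \<Rightarrow> 'a \<Rightarrow> 'a"
  where "cadjoint T = (THE S. \<forall>x y. cinner (T x) y = cinner x (S y))"

definition A_inner :: "('a::complex_inner \<Rightarrow> 'a) \<Rightarrow> 'a \<Rightarrow> 'a \<Rightarrow> complex"
  where "A_inner A x y = cinner (A x) y"

definition A_seminorm :: "('a::complex_inner \<Rightarrow> 'a) \<Rightarrow> 'a \<Rightarrow> real"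
  where "A_seminorm A x = sqrt (Re (A_inner A x x))"

text \<open>In the next two definitions all the values are nonnegative, so inserting 0 only matters
  if no vector has seminorm 1, i.e. if \<open>A = 0\<close>; it fixes the convention that the supremum of
  the empty set is then 0.\<close>

definition A_norm :: "('a::complex_inner \<Rightarrow> 'a) \<Rightarrow> ('a \<Rightarrow> 'a) \<Rightarrow> real"
  where "A_norm A T = Sup (insert 0 {A_seminorm A (T x) | x. A_seminorm A x = 1})"

definition A_numerical_radius :: "('a::complex_inner \<Rightarrow> 'a) \<Rightarrow> ('a \<Rightarrow> 'a) \<Rightarrow> real"
  where "A_numerical_radius A T =
    Sup (insert 0 {cmod (A_inner A (T x) x) | x. A_seminorm A x = 1})"

definition A_adjointable :: "('a::chilbert_space \<Rightarrow> 'a) \<Rightarrow> ('a \<Rightarrow> 'a) set"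
  where "A_adjointable A = {T. bounded_clinear T \<and> range (cadjoint T \<circ> A) \<subseteq> range A}"

definition A_sharp :: "('a::chilbert_space \<Rightarrow> 'a) \<Rightarrow> ('a \<Rightarrow> 'a) \<Rightarrow> 'a \<Rightarrow> 'a"
  where "A_sharp A T = (THE X. bounded_clinear X \<and> A \<circ> X = cadjoint T \<circ> A \<and>
    range X \<subseteq> closure (range A))"

definition block_op :: "('a::complex_inner \<Rightarrow> 'a) \<Rightarrow> ('a \<Rightarrow> 'a) \<Rightarrow> ('a \<Rightarrow> 'a) \<Rightarrow> ('a \<Rightarrow> 'a) \<Rightarrow>
    'a \<times> 'a \<Rightarrow> 'a \<times> 'a"
  where "block_op P Q R S = (\<lambda>(x, y). (P x + Q y, R x + S y))"

end

theory Submission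
  imports Defs
begin

text \<open>
  Write \<open>\<langle>_,_\<rangle>\<close> and \<open>\<parallel>_\<parallel>\<close> for the semi-inner products and seminorms induced by \<open>A\<close> and by the
  diagonal operator on pairs, and let \<open>z = (x, y)\<close> have seminorm 1. The value of the form splits
  into one term per row,
  \<open>\<langle>Tz, z\<rangle> = \<langle>Px + Qy, x\<rangle> + \<langle>Rx + Sy, y\<rangle>\<close>,
  and the two terms are alike, so it suffices to bound the first one by
  \<open>1/2 \<omega>(P) + 1/4 \<parallel>I + P P\<^sup>\<sharp> + Q Q\<^sup>\<sharp>\<parallel>\<close> (lemma \<open>block_row_bound\<close>).

  If \<open>\<parallel>x\<parallel> = 0\<close> the term vanishes by Cauchy--Schwarz. Otherwise put \<open>e = x / \<parallel>x\<parallel>\<close>,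
  \<open>E = (e, 0)\<close> and \<open>v = (P\<^sup>\<sharp> e, Q\<^sup>\<sharp> e)\<close>. Then \<open>\<langle>Px + Qy, x\<rangle> = \<langle>E, z\<rangle> \<langle>z, v\<rangle>\<close>, because
  \<open>\<langle>E, z\<rangle> = \<parallel>x\<parallel>\<close>. As \<open>z\<close> is a unit vector, Buzano's inequality bounds the modulus of this
  product by \<open>1/2 (|\<langle>E, v\<rangle>| + \<parallel>v\<parallel>)\<close>. Here \<open>\<langle>E, v\<rangle> = \<langle>Pe, e\<rangle>\<close> is controlled by \<open>\<omega>(P)\<close>, and
  \<open>2 \<parallel>v\<parallel> \<le> 1 + \<parallel>v\<parallel>\<^sup>2 = \<langle>(I + P P\<^sup>\<sharp> + Q Q\<^sup>\<sharp>) e, e\<rangle>\<close>.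

  The rest is the theory that gives these expressions their meaning. The operator \<open>T\<^sup>\<sharp>\<close> is defined
  by a unique-existence description: solutions of \<open>A u = T\<^sup>* A x\<close> are projected onto the closure
  of the range of \<open>A\<close>, which makes them unique, and the closed graph theorem shows that the
  resulting operator is bounded (\<open>A_sharp_exists\<close>). The Hilbert space adjoint \<open>T\<^sup>*\<close> comes from the
  Riesz representation theorem. A supremum of reals only bounds its members if they are bounded, so
  it must also be known that \<open>T\<close> and \<open>T\<^sup>\<sharp>\<close> are bounded for the seminorm; this is reduced to the
  symmetric operator \<open>T\<^sup>\<sharp> T\<close> and settled there by a growth argument
  (\<open>A_symmetric_imp_A_bounded\<close>).
\<close>

section \<open>The closed graph theorem\<close>

instance chilbert_space \<subseteq> banach ..

text \<open>The Baire half of the closed graph theorem, valid for every linear map on a Banach space: the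
  closures of the sets \<open>{x. norm (f x) \<le> n}\<close> cover the space, so one of them contains a ball.
  Every vector therefore has arbitrarily good approximations whose images are bounded in
  proportion to the vector itself.\<close>

lemma linear_dense_preimage_bound:
  fixes f :: "'a::banach \<Rightarrow> 'b::real_normed_vector"
  assumes "linear f"
  obtains K where "K \<ge> 0"
    and "\<And>x e. e > 0 \<Longrightarrow> \<exists>w. norm (x - w) < e \<and> norm (f w) \<le> K * norm x"
proof -
  interpret linear f by fact
  define B where "B n = {x. norm (f x) \<le> real n}" for n
  have "(\<Union>n. closure (B n)) = UNIV"
  proof -
    have "x \<in> closure (B (nat \<lceil>norm (f x)\<rceil>))" for x
      using closure_subset[of "B (nat \<lceil>norm (f x)\<rceil>)"] real_nat_ceiling_ge[of "norm (f x)"]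
      by (auto simp: B_def)
    then show ?thesis by blast
  qed
  moreover have "interior (\<Union>n. closure (B n)) = {}" if "\<forall>n. interior (closure (B n)) = {}"
    using Baire_category_alt[of "euclidean :: 'a topology" "range (\<lambda>n. closure (B n))"]
      completely_metrizable_space_euclidean that by auto
  ultimately obtain n where "interior (closure (B n)) \<noteq> {}"
    by fastforce
  then obtain a r where r: "r > 0" and ball: "ball a r \<subseteq> closure (B n)"
    by (metis all_not_in_conv mem_interior)
  \<comment> \<open>The set \<open>B n\<close> is symmetric and convex, so the ball can be moved to the origin.\<close>
  have near: "\<exists>w. norm (x - w) < e \<and> norm (f w) \<le> real n" if x: "norm x < r" and e: "e > 0" for x e
  proof -
    have "a + x \<in> closure (B n)" "a - x \<in> closure (B n)"
      using ball x by (auto simp: subset_iff dist_norm)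
    then obtain u v where u: "u \<in> B n" "dist u (a + x) < e" and v: "v \<in> B n" "dist v (a - x) < e"
      using e by (meson closure_approachable)
    define w where "w = (1/2) *\<^sub>R (u - v)"
    have "norm (f w) \<le> 1/2 * (norm (f u) + norm (f v))"
      unfolding w_def scale diff by (simp add: norm_triangle_ineq4)
    then have "norm (f w) \<le> real n"
      using u v by (simp add: B_def)
    moreover have eq: "x - w = (1/2) *\<^sub>R (((a + x) - u) - ((a - x) - v))"
      by (simp add: w_def algebra_simps flip: scaleR_left_distrib)
    have half: "\<bar>1/2\<bar> = (1/2 :: real)" by simp
    have "norm (x - w) \<le> 1/2 * (norm ((a + x) - u) + norm ((a - x) - v))"
      unfolding eq norm_scaleR half by (intro mult_left_mono norm_triangle_ineq4) simp
    then have "norm (x - w) < e"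
      using u v by (simp add: dist_norm norm_minus_commute)
    ultimately show ?thesis by blast
  qed
  show thesis
  proof
    show "2 * real n / r \<ge> 0" using r by simp
    fix x :: 'a and e :: real
    assume e: "e > 0"
    show "\<exists>w. norm (x - w) < e \<and> norm (f w) \<le> 2 * real n / r * norm x"
    proof (cases "x = 0")
      case True
      with e show ?thesis by (intro exI[of _ 0]) (simp add: zero)
    next
      case False
      define c where "c = r / (2 * norm x)"
      have c: "c > 0" using False r by (simp add: c_def)
      have "norm (c *\<^sub>R x) < r"
        using False r by (simp add: c_def)
      from near[OF this, of "c * e"] c e obtain w
        where w: "norm (c *\<^sub>R x - w) < c * e" "norm (f w) \<le> real n"
        by auto
      have "x - (1/c) *\<^sub>R w = (1/c) *\<^sub>R (c *\<^sub>R x - w)"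
        using c by (simp add: algebra_simps)
      then have "c * norm (x - (1/c) *\<^sub>R w) = norm (c *\<^sub>R x - w)"
        using c by simp
      then have "norm (x - (1/c) *\<^sub>R w) < e"
        using w c by (metis mult_less_cancel_left_pos)
      moreover have "norm (f ((1/c) *\<^sub>R w)) \<le> 2 * real n / r * norm x"
      proof -
        have "norm (f ((1/c) *\<^sub>R w)) = (1/c) * norm (f w)"
          using c by (simp add: scale)
        also have "\<dots> \<le> (1/c) * real n"
          using w c by (intro mult_left_mono) auto
        also have "\<dots> = 2 * real n / r * norm x"
          using r False by (simp add: c_def)
        finally show ?thesis .
      qed
      ultimately show ?thesis by blast
    qed
  qed
qed

text \<open>Approximating \<open>x\<close>, then the remainder, then the remainder of that, with errors that halve
  each time, writes \<open>x\<close> as a series \<open>w 0 + w 1 + \<dots>\<close> whose image series converges absolutely;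
  closedness of the graph identifies the sum of the images with \<open>f x\<close>.\<close>

theorem closed_graph_imp_bounded_linear:
  fixes f :: "'a::banach \<Rightarrow> 'b::banach"
  assumes lin: "linear f"
    and closed: "\<And>X x y. X \<longlonglongrightarrow> x \<Longrightarrow> (\<lambda>n. f (X n)) \<longlonglongrightarrow> y \<Longrightarrow> f x = y"
  shows "bounded_linear f"
proof -
  interpret linear f by fact
  obtain K where K: "K \<ge> 0"
    and approx: "\<And>x e. e > 0 \<Longrightarrow> \<exists>w. norm (x - w) < e \<and> norm (f w) \<le> K * norm x"
    using linear_dense_preimage_bound[OF lin] by blast
  then have "\<forall>x e. \<exists>w. e > 0 \<longrightarrow> norm (x - w) < e \<and> norm (f w) \<le> K * norm x"
    by blast
  then obtain g where g: "\<And>x e. e > 0 \<Longrightarrow> norm (x - g x e) < e \<and> norm (f (g x e)) \<le> K * norm x"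
    unfolding choice_iff by blast
  have "norm (f x) \<le> norm x * (K * 2)" for x
  proof (cases "x = 0")
    case True
    then show ?thesis by (simp add: zero)
  next
    case False
    \<comment> \<open>\<open>Z k\<close> is the remainder after \<open>k\<close> approximation steps and \<open>w k\<close> the next term.\<close>
    define Z where "Z = rec_nat x (\<lambda>k z. z - g z (norm x / 2 ^ Suc k))"
    define w where "w k = g (Z k) (norm x / 2 ^ Suc k)" for k
    have Z0: "Z 0 = x" and ZSuc: "Z (Suc k) = Z k - w k" for k
      by (simp_all add: Z_def w_def)
    have nZ: "norm (Z k) \<le> norm x / 2 ^ k" for k
    proof (cases k)
      case (Suc m)
      then show ?thesis
        using g[of "norm x / 2 ^ Suc m" "Z m"] False by (simp add: ZSuc w_def)
    qed (simp add: Z0)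
    have nw: "norm (f (w k)) \<le> K * norm x * (1/2) ^ k" for k
    proof -
      have "norm (f (w k)) \<le> K * norm (Z k)"
        using g[of "norm x / 2 ^ Suc k" "Z k"] False by (simp add: w_def)
      also have "\<dots> \<le> K * (norm x / 2 ^ k)"
        using nZ K by (intro mult_left_mono) auto
      finally show ?thesis by (simp add: power_divide)
    qed
    have sums: "(\<lambda>k. K * norm x * (1/2) ^ k) sums (K * norm x * 2)"
      using sums_mult[OF geometric_sums[of "1/2::real"], of "K * norm x"] by simp
    have summable: "summable (\<lambda>k. norm (f (w k)))"
      using sums nw by (intro summable_comparison_test'[OF sums_summable[OF sums], of 0]) auto
    have part: "f (x - Z k) = (\<Sum>i<k. f (w i))" for k
    proof (induction k)
      case (Suc k)
      have "f (x - Z (Suc k)) = f ((x - Z k) + w k)" by (simp add: ZSuc algebra_simps)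
      then show ?case using Suc by (simp only: add sum.lessThan_Suc)
    qed (simp add: Z0 zero)
    have "(\<lambda>k. norm x / 2 ^ k) \<longlonglongrightarrow> 0"
      using tendsto_mult_right_zero[OF LIMSEQ_power_zero[of "1/2::real"], of "norm x"]
      by (simp add: power_divide)
    then have "Z \<longlonglongrightarrow> 0"
      by (rule Lim_null_comparison[rotated]) (simp add: nZ)
    then have "(\<lambda>k. x - Z k) \<longlonglongrightarrow> x"
      using tendsto_diff[OF tendsto_const, of Z 0 sequentially x] by simp
    moreover have "(\<lambda>k. f (x - Z k)) \<longlonglongrightarrow> (\<Sum>k. f (w k))"
      unfolding part by (rule summable_LIMSEQ[OF summable_norm_cancel[OF summable]])
    ultimately have "f x = (\<Sum>k. f (w k))" by (rule closed)
    then have "norm (f x) \<le> (\<Sum>k. norm (f (w k)))"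
      using summable_norm[OF summable] by simp
    also have "\<dots> \<le> (\<Sum>k. K * norm x * (1/2) ^ k)"
      by (rule suminf_le[OF nw summable sums_summable[OF sums]])
    finally show ?thesis
      using sums by (simp add: sums_iff mult_ac)
  qed
  then show ?thesis
    by (intro bounded_linear_intro[where K = "K * 2"]) (auto simp: add scale)
qed

section \<open>Orthogonal projection and Riesz representation\<close>

text \<open>A minimizing sequence for the distance from \<open>x\<close> to \<open>M\<close> is Cauchy by the parallelogram law, and
  minimality of its limit along each line in \<open>M\<close> forces orthogonality.\<close>

theorem orthogonal_projection_exists:
  fixes M :: "'a::{real_inner, complete_space} set"
  assumes M: "subspace M" "closed M"
  shows "\<exists>m\<in>M. \<forall>y\<in>M. inner (x - m) y = 0"
proof -
  have ne: "M \<noteq> {}" using subspace_0[OF M(1)] by blast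
  define d where "d = infdist x M"
  have d0: "d \<ge> 0" by (simp add: d_def infdist_nonneg)
  have dle: "d\<^sup>2 \<le> (norm (x - y))\<^sup>2" if "y \<in> M" for y
    using infdist_le[OF that, of x] d0 by (intro power_mono) (auto simp: d_def dist_norm)
  have "\<exists>y\<in>M. (norm (x - y))\<^sup>2 < d\<^sup>2 + e" if "e > 0" for e
  proof -
    have "d < sqrt (d\<^sup>2 + e)" using that by (simp add: real_less_rsqrt)
    then obtain y where "y \<in> M" "dist x y < sqrt (d\<^sup>2 + e)"
      by (metis infdist_notempty[OF ne] d_def cINF_less_iff ne bdd_below_image_dist)
    then have "(norm (x - y))\<^sup>2 < (sqrt (d\<^sup>2 + e))\<^sup>2"
      by (intro power_strict_mono) (auto simp: dist_norm)
    then show ?thesis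
      using \<open>y \<in> M\<close> that by (intro bexI[of _ y]) auto
  qed
  then have "\<forall>n. \<exists>y\<in>M. (norm (x - y))\<^sup>2 < d\<^sup>2 + inverse (real (Suc n))" by simp
  then obtain m where mM: "\<And>n. m n \<in> M"
    and md: "\<And>n. (norm (x - m n))\<^sup>2 < d\<^sup>2 + inverse (real (Suc n))"
    by metis
  \<comment> \<open>Parallelogram law: the midpoint of two nearly closest points lies in \<open>M\<close> as well.\<close>
  have gap: "(norm (m i - m j))\<^sup>2 \<le> 2 * inverse (real (Suc i)) + 2 * inverse (real (Suc j))" for i j
  proof -
    have "(1/2) *\<^sub>R (m i + m j) \<in> M"
      using mM M(1) by (simp add: subspace_add subspace_scale)
    note mid = dle[OF this]
    have "(norm (m i - m j))\<^sup>2 = 2 * (norm (x - m i))\<^sup>2 + 2 * (norm (x - m j))\<^sup>2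
        - 4 * (norm (x - (1/2) *\<^sub>R (m i + m j)))\<^sup>2"
      unfolding power2_norm_eq_inner inner_diff_left inner_diff_right inner_add_left inner_add_right
      by (simp add: inner_add_left inner_add_right inner_commute algebra_simps)
    then show ?thesis using mid md[of i] md[of j] by linarith
  qed
  have "Cauchy m"
  proof (rule metric_CauchyI)
    fix e :: real assume e: "e > 0"
    then obtain N where N: "inverse (real (Suc N)) < e\<^sup>2 / 4"
      using reals_Archimedean[of "e\<^sup>2 / 4"] by auto
    have "dist (m i) (m j) < e" if "i \<ge> N" "j \<ge> N" for i j
    proof -
      have "inverse (real (Suc i)) \<le> inverse (real (Suc N))" "inverse (real (Suc j)) \<le> inverse (real (Suc N))"
        using that by (auto intro!: le_imp_inverse_le)
      then have "(norm (m i - m j))\<^sup>2 < e\<^sup>2" using gap[of i j] N by linarith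
      then show ?thesis using e by (simp add: dist_norm power_less_imp_less_base)
    qed
    then show "\<exists>N. \<forall>i\<ge>N. \<forall>j\<ge>N. dist (m i) (m j) < e" by blast
  qed
  then obtain l where l: "m \<longlonglongrightarrow> l"
    using Cauchy_convergent_iff convergent_def by blast
  have lM: "l \<in> M" using closed_sequentially[OF M(2) mM l] .
  have "(\<lambda>n. (norm (x - m n))\<^sup>2) \<longlonglongrightarrow> (norm (x - l))\<^sup>2"
    by (intro tendsto_intros l)
  moreover have "(\<lambda>n. d\<^sup>2 + inverse (real (Suc n))) \<longlonglongrightarrow> d\<^sup>2"
    using tendsto_add[OF tendsto_const LIMSEQ_inverse_real_of_nat] by simp
  ultimately have ld: "(norm (x - l))\<^sup>2 \<le> d\<^sup>2"
    by (rule LIMSEQ_le) (use md less_imp_le in blast)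
  have "inner (x - l) y = 0" if y: "y \<in> M" for y
  proof (cases "y = 0")
    case False
    \<comment> \<open>This step along \<open>y\<close> decreases the distance most.\<close>
    define t where "t = inner (x - l) y / inner y y"
    have "l + t *\<^sub>R y \<in> M" using lM y M(1) by (simp add: subspace_add subspace_scale)
    then have "(norm (x - l))\<^sup>2 \<le> (norm ((x - l) - t *\<^sub>R y))\<^sup>2"
      using dle ld by (smt (verit) diff_diff_add)
    also have "\<dots> = (norm (x - l))\<^sup>2 - 2 * t * inner (x - l) y + t * t * inner y y"
      unfolding power2_norm_eq_inner inner_diff_left inner_diff_right
      by (simp add: inner_commute algebra_simps)
    also have "\<dots> = (norm (x - l))\<^sup>2 - (inner (x - l) y)\<^sup>2 / inner y y"
      using False by (simp add: t_def power2_eq_square field_simps)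
    finally have "(inner (x - l) y)\<^sup>2 / inner y y \<le> 0" by simp
    then show ?thesis using False
      by (smt (verit) divide_pos_pos inner_gt_zero_iff zero_less_power2)
  qed simp
  then show ?thesis using lM by blast
qed

text \<open>Away from the trivial case, the representing vector spans the orthogonal complement of the
  kernel.\<close>

corollary riesz_representation:
  fixes f :: "'a::{real_inner, complete_space} \<Rightarrow> real"
  assumes "bounded_linear f"
  obtains z where "\<And>x. f x = inner x z"
proof (cases "\<forall>x. f x = 0")
  case True
  then show thesis using that[of 0] by simp
next
  case False
  then obtain x where x: "f x \<noteq> 0" by blast
  interpret bounded_linear f by fact
  have "subspace {y. f y = 0}" by (simp add: subspace_def add scale zero)
  moreover have "closed {y. f y = 0}"
    by (intro closed_Collect_eq continuous_on continuous_on_const linear_continuous_on assms)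
  ultimately obtain m where m: "f m = 0" and orth: "\<And>y. f y = 0 \<Longrightarrow> inner (x - m) y = 0"
    using orthogonal_projection_exists[of "{y. f y = 0}" x] by auto
  define u where "u = x - m"
  have fu: "f u \<noteq> 0" using x m by (simp add: u_def diff)
  then have u0: "inner u u \<noteq> 0" using zero by auto
  show thesis
  proof
    fix y
    have "f (f u *\<^sub>R y - f y *\<^sub>R u) = 0" by (simp add: diff scale)
    then have "inner u (f u *\<^sub>R y - f y *\<^sub>R u) = 0" unfolding u_def by (rule orth)
    then have "f u * inner u y = f y * inner u u" by (simp add: inner_diff)
    then show "f y = inner y ((f u / inner u u) *\<^sub>R u)"
      using u0 by (simp add: inner_commute field_simps)
  qed
qed

section \<open>Complex inner products and adjoints\<close>

lemma cinner_scaleC_right: "cinner x (c *\<^sub>C y) = cnj c * cinner x y"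
  by (metis cinner_commute cinner_scaleC_left complex_cnj_mult)

lemma cinner_add_right: "cinner x (y + z) = cinner x y + cinner x z"
  by (metis cinner_commute cinner_add_left complex_cnj_add)

lemma cinner_zero_left: "cinner 0 y = 0"
  using cinner_add_left[of 0 0 y] by simp

lemma cinner_zero_right: "cinner x 0 = 0"
  using cinner_add_right[of x 0 0] by simp

text \<open>The complex inner product is determined by its real part. This transports the real Riesz
  theorem to complex adjoints.\<close>

lemma cinner_eq_inner: "cinner x y = Complex (inner x y) (inner x (\<i> *\<^sub>C y))"
proof -
  have "Im (cinner x y) = Re (cinner x (\<i> *\<^sub>C y))"
    by (simp add: cinner_scaleC_right)
  then show ?thesis by (simp add: complex_eq_iff Re_cinner)
qed

lemma cinner_right_eqI:
  assumes "\<And>x. cinner x y = cinner x z"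
  shows "y = z"
  by (metis assms Re_cinner vector_eq_ldot)

lemma cadjoint_exists:
  fixes T :: "'a::chilbert_space \<Rightarrow> 'a"
  assumes T: "bounded_clinear T"
  obtains S where "\<And>x y. cinner (T x) y = cinner x (S y)"
proof -
  have lin: "bounded_linear T" and TC: "\<And>c x. T (c *\<^sub>C x) = c *\<^sub>C T x"
    using T by (auto simp: bounded_clinear_def)
  have "\<exists>z. \<forall>x. inner (T x) y = inner x z" for y
    using riesz_representation[OF bounded_linear_compose[OF bounded_linear_inner_left lin], of y]
    by metis
  then obtain S where S: "\<And>x y. inner (T x) y = inner x (S y)" by metis
  have "cinner (T x) y = cinner x (S y)" for x y
  proof -
    have *: "inner u (\<i> *\<^sub>C v) = - inner (\<i> *\<^sub>C u) v" for u v :: 'a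
      by (simp add: cinner_scaleC_left cinner_scaleC_right flip: Re_cinner)
    show ?thesis
      unfolding cinner_eq_inner * by (simp add: S flip: TC)
  qed
  then show thesis by (rule that)
qed

lemma cinner_cadjoint:
  fixes T :: "'a::chilbert_space \<Rightarrow> 'a"
  assumes "bounded_clinear T"
  shows "cinner (T x) y = cinner x (cadjoint T y)"
proof -
  obtain S where S: "\<And>x y. cinner (T x) y = cinner x (S y)"
    using cadjoint_exists[OF assms] by blast
  have "\<forall>x y. cinner (T x) y = cinner x (cadjoint T y)"
    unfolding cadjoint_def
  proof (rule theI[of "\<lambda>S. \<forall>x y. cinner (T x) y = cinner x (S y)"])
    show "\<forall>x y. cinner (T x) y = cinner x (S y)" using S by blast
    fix S' assume "\<forall>x y. cinner (T x) y = cinner x (S' y)"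
    then show "S' = S" using S by (metis cinner_right_eqI ext)
  qed
  then show ?thesis by blast
qed

section \<open>The semi-inner product induced by a positive operator\<close>

locale positive_operator =
  fixes A :: "'a::complex_inner \<Rightarrow> 'a"
  assumes positive: "positive_op A"
begin

lemma bounded_linear_A: "bounded_linear A" and A_scaleC: "A (c *\<^sub>C x) = c *\<^sub>C A x"
  using positive by (auto simp: positive_op_def bounded_clinear_def)

sublocale A: bounded_linear A by (rule bounded_linear_A)

lemma A_inner_add_left: "A_inner A (x + y) z = A_inner A x z + A_inner A y z"
  by (simp add: A_inner_def A.add cinner_add_left)

lemma A_inner_add_right: "A_inner A x (y + z) = A_inner A x y + A_inner A x z"
  by (simp add: A_inner_def cinner_add_right)

lemma A_inner_scaleC_left: "A_inner A (c *\<^sub>C x) y = c * A_inner A x y"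
  by (simp add: A_inner_def A_scaleC cinner_scaleC_left)

lemma A_inner_scaleC_right: "A_inner A x (c *\<^sub>C y) = cnj c * A_inner A x y"
  by (simp add: A_inner_def cinner_scaleC_right)

lemma A_inner_scaleR_left: "A_inner A (r *\<^sub>R x) y = of_real r * A_inner A x y"
  by (metis A_inner_scaleC_left scaleC_of_real)

lemma A_inner_scaleR_right: "A_inner A x (r *\<^sub>R y) = of_real r * A_inner A x y"
  by (metis A_inner_scaleC_right scaleC_of_real complex_cnj_complex_of_real)

lemma A_inner_self: "Im (A_inner A x x) = 0" "Re (A_inner A x x) \<ge> 0"
  using positive by (auto simp: positive_op_def A_inner_def complex_nonneg_Reals_iff)

text \<open>Positivity implies symmetry by polarization: the quadratic form is real at \<open>x + y\<close> and at
  \<open>x + \<i> y\<close>, which compares the imaginary and the real parts respectively.\<close>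

lemma A_inner_commute: "A_inner A x y = cnj (A_inner A y x)"
proof -
  have "Im (A_inner A (x + y) (x + y)) = 0" "Im (A_inner A (x + \<i> *\<^sub>C y) (x + \<i> *\<^sub>C y)) = 0"
    by (rule A_inner_self)+
  then show ?thesis
    using A_inner_self(1)[of x] A_inner_self(1)[of y]
    by (simp add: complex_eq_iff A_inner_add_left A_inner_add_right A_inner_scaleC_left
        A_inner_scaleC_right)
qed

lemma A_symmetric: "cinner (A x) y = cinner x (A y)"
  by (metis A_inner_commute A_inner_def cinner_commute)

lemma A_symmetric_inner: "inner (A x) y = inner x (A y)"
  by (simp only: A_symmetric flip: Re_cinner)

lemma A_seminorm_nonneg: "A_seminorm A x \<ge> 0"
  by (simp add: A_seminorm_def A_inner_self)

lemma A_seminorm_power2: "(A_seminorm A x)\<^sup>2 = Re (A_inner A x x)"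
  by (simp add: A_seminorm_def A_inner_self)

lemma A_inner_self_eq: "A_inner A x x = of_real ((A_seminorm A x)\<^sup>2)"
  by (simp add: A_seminorm_power2 complex_eq_iff A_inner_self)

lemma A_seminorm_scaleR: "A_seminorm A (r *\<^sub>R x) = \<bar>r\<bar> * A_seminorm A x"
  by (simp add: A_seminorm_def A_inner_scaleR_left A_inner_scaleR_right real_sqrt_mult
      flip: mult.assoc)

lemma Re_A_inner_le: "Re (A_inner A x y) \<le> A_seminorm A x * A_seminorm A y"
proof -
  \<comment> \<open>The quadratic polynomial \<open>p + 2 t b + t\<^sup>2 q\<close> is nonnegative, so its discriminant is not positive.\<close>
  define p q b where "p = (A_seminorm A x)\<^sup>2" and "q = (A_seminorm A y)\<^sup>2"
    and "b = Re (A_inner A x y)"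
  have sym: "Re (A_inner A y x) = b"
    by (metis A_inner_commute b_def cnj.sel(1))
  have nonneg: "0 \<le> p + 2 * t * b + t * t * q" for t
  proof -
    have "0 \<le> Re (A_inner A (x + t *\<^sub>R y) (x + t *\<^sub>R y))" by (rule A_inner_self)
    also have "\<dots> = p + 2 * t * b + t * t * q"
      by (simp add: A_inner_add_left A_inner_add_right A_inner_scaleR_left A_inner_scaleR_right
          p_def q_def A_seminorm_power2 sym algebra_simps flip: b_def)
    finally show ?thesis .
  qed
  have "b\<^sup>2 \<le> p * q"
  proof (cases "q = 0")
    case False
    then have q: "q > 0" by (simp add: q_def)
    have "0 \<le> p + 2 * (- b / q) * b + (- b / q) * (- b / q) * q" by (rule nonneg)
    also have "\<dots> = p - b\<^sup>2 / q" using q by (simp add: field_simps power2_eq_square)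
    finally show ?thesis using q by (simp add: field_simps)
  next
    case True
    have "b = 0"
    proof (rule ccontr)
      \<comment> \<open>A nonconstant affine function takes the value \<open>-1\<close>.\<close>
      assume "b \<noteq> 0"
      then show False
        using nonneg[of "- (p + 1) / (2 * b)"] True by (simp add: field_simps)
    qed
    then show ?thesis using True by simp
  qed
  then have "b\<^sup>2 \<le> (A_seminorm A x * A_seminorm A y)\<^sup>2"
    by (simp add: p_def q_def power_mult_distrib)
  then show ?thesis
    unfolding b_def by (rule power2_le_imp_le) (simp add: A_seminorm_nonneg)
qed

lemma A_seminorm_scaleC: "A_seminorm A (c *\<^sub>C x) = cmod c * A_seminorm A x"
proof -
  have "A_inner A (c *\<^sub>C x) (c *\<^sub>C x) = of_real ((cmod c)\<^sup>2) * A_inner A x x"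
    by (simp only: A_inner_scaleC_left A_inner_scaleC_right complex_norm_square mult_ac)
  then show ?thesis
    by (simp add: A_seminorm_def real_sqrt_mult)
qed

text \<open>Multiplying one argument by a phase makes the semi-inner product real and nonnegative, so
  the bound on real parts suffices.\<close>

lemma A_inner_Cauchy_Schwarz: "cmod (A_inner A x y) \<le> A_seminorm A x * A_seminorm A y"
proof (cases "A_inner A x y = 0")
  case True
  then show ?thesis by (simp add: A_seminorm_nonneg)
next
  case False
  define c where "c = cnj (sgn (A_inner A x y))"
  have c: "cmod c = 1" using False by (simp add: c_def norm_sgn)
  have "c * A_inner A x y = of_real (cmod (A_inner A x y))"
    using False by (simp add: c_def sgn_eq complex_norm_square[symmetric] mult.commute[of "cnj _"]
        power2_eq_square)
  then have "cmod (A_inner A x y) = Re (A_inner A (c *\<^sub>C x) y)"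
    by (simp add: A_inner_scaleC_left)
  also have "\<dots> \<le> A_seminorm A (c *\<^sub>C x) * A_seminorm A y" by (rule Re_A_inner_le)
  finally show ?thesis by (simp add: A_seminorm_scaleC c)
qed

text \<open>Buzano's refinement of the Cauchy--Schwarz inequality. Reflection in the line spanned by
  the unit vector \<open>e\<close> preserves the seminorm, and the product on the
  left is half the semi-inner product of \<open>a + r\<close> with \<open>b\<close>, where \<open>r\<close> is the reflection of \<open>a\<close>.\<close>

lemma Buzano_inequality:
  assumes e: "A_seminorm A e = 1"
  shows "cmod (A_inner A a e * A_inner A e b)
    \<le> 1/2 * (cmod (A_inner A a b) + A_seminorm A a * A_seminorm A b)"
proof -
  define k where "k = A_inner A a e"
  define r where "r = (2 * k) *\<^sub>C e + (- 1) *\<^sub>C a"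
  have ee: "A_inner A e e = 1" using A_inner_self_eq[of e] e by simp
  have ea: "A_inner A e a = cnj k" unfolding k_def by (rule A_inner_commute)
  have "A_inner A r r = A_inner A a a"
    by (simp add: r_def A_inner_add_left A_inner_add_right A_inner_scaleC_left
        A_inner_scaleC_right ee ea algebra_simps flip: k_def)
  then have r: "A_seminorm A r = A_seminorm A a" by (simp add: A_seminorm_def)
  have "2 * (k * A_inner A e b) = A_inner A a b + A_inner A r b"
    by (simp add: r_def A_inner_add_left A_inner_scaleC_left)
  then have "2 * cmod (k * A_inner A e b) = cmod (A_inner A a b + A_inner A r b)"
    by (metis norm_mult norm_numeral)
  also have "\<dots> \<le> cmod (A_inner A a b) + A_seminorm A a * A_seminorm A b"
    using norm_triangle_ineq[of "A_inner A a b" "A_inner A r b"] A_inner_Cauchy_Schwarz[of r b]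
    by (simp add: r)
  finally show ?thesis by (simp add: k_def)
qed

lemma A_seminorm_triangle: "A_seminorm A (x + y) \<le> A_seminorm A x + A_seminorm A y"
proof (rule power2_le_imp_le)
  have "Re (A_inner A y x) = Re (A_inner A x y)"
    by (metis A_inner_commute cnj.sel(1))
  then show "(A_seminorm A (x + y))\<^sup>2 \<le> (A_seminorm A x + A_seminorm A y)\<^sup>2"
    using Re_A_inner_le[of x y]
    by (simp add: A_seminorm_power2 A_inner_add_left A_inner_add_right power2_sum)
qed (simp add: A_seminorm_nonneg)

lemma A_seminorm_le_norm: obtains K where "K \<ge> 0" "\<And>x. A_seminorm A x \<le> K * norm x"
proof -
  obtain B where B: "B > 0" "\<And>x. norm (A x) \<le> norm x * B"
    using A.pos_bounded by blast
  have "A_seminorm A x \<le> sqrt B * norm x" for x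
  proof -
    have "Re (A_inner A x x) \<le> norm (A x) * norm x"
      using Cauchy_Schwarz_ineq2[of "A x" x] by (simp add: A_inner_def Re_cinner)
    also have "\<dots> \<le> B * (norm x)\<^sup>2"
      using mult_right_mono[OF B(2)[of x], of "norm x"] by (simp add: power2_eq_square mult_ac)
    finally show ?thesis
      using B by (metis A_seminorm_def norm_ge_zero real_sqrt_le_mono real_sqrt_mult real_sqrt_abs abs_of_nonneg)
  qed
  then show thesis using B by (intro that[of "sqrt B"]) auto
qed

definition A_bounded :: "('a \<Rightarrow> 'a) \<Rightarrow> bool"
  where "A_bounded T \<longleftrightarrow> (\<exists>L. \<forall>x. A_seminorm A (T x) \<le> L * A_seminorm A x)"

text \<open>Krein's argument: along the orbit of \<open>x\<close> under a symmetric \<open>C\<close> the seminorms form a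
  log-convex sequence, so a first ratio above a norm bound \<open>L\<close> of \<open>C\<close> would force growth
  faster than the norms of the iterates allow.\<close>

lemma A_symmetric_imp_A_bounded:
  assumes C: "bounded_linear C" and sym: "\<And>x y. A_inner A (C x) y = A_inner A x (C y)"
  shows "A_bounded C"
proof -
  obtain L where L: "L > 0" "\<And>x. norm (C x) \<le> norm x * L"
    using bounded_linear.pos_bounded[OF C] by blast
  obtain K where K: "K \<ge> 0" "\<And>x. A_seminorm A x \<le> K * norm x"
    using A_seminorm_le_norm by blast
  have "A_seminorm A (C x) \<le> L * A_seminorm A x" for x
  proof (rule ccontr)
    assume neg: "\<not> ?thesis"
    define s where "s n = A_seminorm A ((C ^^ n) x)" for n
    have s_nonneg: "s n \<ge> 0" for n by (simp add: s_def A_seminorm_nonneg)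
    have convex: "(s (Suc n))\<^sup>2 \<le> s n * s (Suc (Suc n))" for n
    proof -
      have "(s (Suc n))\<^sup>2 = Re (A_inner A ((C ^^ n) x) ((C ^^ Suc (Suc n)) x))"
        by (simp add: s_def A_seminorm_power2 sym)
      also have "\<dots> \<le> s n * s (Suc (Suc n))"
        unfolding s_def by (rule Re_A_inner_le)
      finally show ?thesis .
    qed
    have s1: "s 1 > L * s 0" using neg by (simp add: s_def)
    have s1_pos: "s 1 > 0" using s1 s_nonneg[of 0] L by (smt (verit) mult_nonneg_nonneg)
    have s0: "s 0 > 0"
      using convex[of 0] s_nonneg[of 0] s1_pos by (cases "s 0 = 0") auto
    define r where "r = s 1 / s 0"
    have r: "r > L" using s1 s0 by (simp add: r_def field_simps)
    have ratio: "s n > 0 \<and> s (Suc n) \<ge> r * s n" for n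
    proof (induction n)
      case 0
      then show ?case using s0 by (simp add: r_def)
    next
      case (Suc n)
      then have pos: "s (Suc n) > 0" using r L by (smt (verit) mult_pos_pos)
      have "r * s n * s (Suc n) \<le> (s (Suc n))\<^sup>2"
        using Suc pos by (simp add: power2_eq_square)
      also have "\<dots> \<le> s n * s (Suc (Suc n))" by (rule convex)
      finally have "s n * (r * s (Suc n)) \<le> s n * s (Suc (Suc n))" by (simp add: mult_ac)
      then show ?case using Suc pos by simp
    qed
    have lower: "r ^ n * s 0 \<le> s n" for n
    proof (induction n)
      case (Suc n)
      have "r ^ Suc n * s 0 \<le> r * s n"
        using mult_left_mono[OF Suc, of r] r L by (simp add: mult_ac)
      then show ?case using ratio[of n] by linarith
    qed simp
    have "norm ((C ^^ n) x) \<le> L ^ n * norm x" for n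
    proof (induction n)
      case (Suc n)
      have "norm ((C ^^ Suc n) x) \<le> norm ((C ^^ n) x) * L" using L(2) by simp
      also have "\<dots> \<le> (L ^ n * norm x) * L" using Suc L by (intro mult_right_mono) auto
      finally show ?case by (simp add: mult_ac)
    qed simp
    then have upper: "s n \<le> K * (L ^ n * norm x)" for n
      unfolding s_def using K(2) K(1) by (meson mult_left_mono order_trans)
    have "(r / L) ^ n \<le> K * norm x / s 0" for n
    proof -
      have "r ^ n * s 0 \<le> K * norm x * L ^ n"
        using lower[of n] upper[of n] by (simp add: mult_ac)
      then show ?thesis using L s0 by (simp add: power_divide field_simps)
    qed
    moreover obtain n where "K * norm x / s 0 < (r / L) ^ n"
      using real_arch_pow[of "r / L" "K * norm x / s 0"] r L by auto
    ultimately show False by (meson not_le)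
  qed
  then show ?thesis unfolding A_bounded_def by blast
qed

text \<open>If \<open>U\<close> and \<open>V\<close> are adjoint to each other, then \<open>V U\<close> is symmetric, hence bounded for the
  seminorm, and \<open>\<parallel>U x\<parallel>\<^sup>2 = \<langle>x, V U x\<rangle>\<close> passes the bound on to \<open>U\<close>. The roles of \<open>U\<close> and \<open>V\<close>
  can be exchanged.\<close>

lemma A_bounded_if_adjoint_pair:
  assumes T: "bounded_linear T" and X: "bounded_linear X"
    and adj: "\<And>x y. A_inner A (T x) y = A_inner A x (X y)"
  shows "A_bounded T" "A_bounded X"
proof -
  have adj': "A_inner A (X x) y = A_inner A x (T y)" for x y
    by (metis A_inner_commute adj)
  have bounded: "A_bounded U"
    if U: "bounded_linear U" and V: "bounded_linear V"
      and UV: "\<And>x y. A_inner A (U x) y = A_inner A x (V y)"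
      and VU: "\<And>x y. A_inner A (V x) y = A_inner A x (U y)" for U V
  proof -
    have "A_bounded (\<lambda>x. V (U x))"
      by (rule A_symmetric_imp_A_bounded)
        (auto intro: bounded_linear_compose U V simp: UV VU)
    then obtain L where L: "\<And>x. A_seminorm A (V (U x)) \<le> L * A_seminorm A x"
      unfolding A_bounded_def by blast
    have "A_seminorm A (U x) \<le> sqrt \<bar>L\<bar> * A_seminorm A x" for x
    proof (rule power2_le_imp_le)
      have "(A_seminorm A (U x))\<^sup>2 = Re (A_inner A x (V (U x)))"
        by (simp add: A_seminorm_power2 UV)
      also have "\<dots> \<le> A_seminorm A x * A_seminorm A (V (U x))" by (rule Re_A_inner_le)
      also have "\<dots> \<le> A_seminorm A x * (\<bar>L\<bar> * A_seminorm A x)"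
      proof (rule mult_left_mono[OF _ A_seminorm_nonneg])
        show "A_seminorm A (V (U x)) \<le> \<bar>L\<bar> * A_seminorm A x"
          using L[of x] mult_right_mono[OF abs_ge_self[of L] A_seminorm_nonneg[of x]] by linarith
      qed
      finally show "(A_seminorm A (U x))\<^sup>2 \<le> (sqrt \<bar>L\<bar> * A_seminorm A x)\<^sup>2"
        by (simp add: power_mult_distrib power2_eq_square mult_ac)
    qed (simp add: A_seminorm_nonneg)
    then show ?thesis unfolding A_bounded_def by blast
  qed
  show "A_bounded T" by (rule bounded[OF T X adj adj'])
  show "A_bounded X" by (rule bounded[OF X T adj' adj])
qed

lemma A_bounded_add:
  assumes "A_bounded T" "A_bounded U"
  shows "A_bounded (\<lambda>x. T x + U x)"
proof -
  obtain L M where "\<And>x. A_seminorm A (T x) \<le> L * A_seminorm A x"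
      "\<And>x. A_seminorm A (U x) \<le> M * A_seminorm A x"
    using assms unfolding A_bounded_def by blast
  then have "A_seminorm A (T x + U x) \<le> (L + M) * A_seminorm A x" for x
    by (smt (verit) A_seminorm_triangle distrib_right)
  then show ?thesis unfolding A_bounded_def by blast
qed

lemma A_bounded_compose:
  assumes "A_bounded T" "A_bounded U"
  shows "A_bounded (\<lambda>x. T (U x))"
proof -
  obtain L M where L: "\<And>x. A_seminorm A (T x) \<le> L * A_seminorm A x"
      and M: "\<And>x. A_seminorm A (U x) \<le> M * A_seminorm A x"
    using assms unfolding A_bounded_def by blast
  have "A_seminorm A (T (U x)) \<le> \<bar>L\<bar> * (M * A_seminorm A x)" for x
  proof -
    have "A_seminorm A (T (U x)) \<le> \<bar>L\<bar> * A_seminorm A (U x)"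
      using L[of "U x"] mult_right_mono[OF abs_ge_self[of L] A_seminorm_nonneg[of "U x"]] by linarith
    also have "\<dots> \<le> \<bar>L\<bar> * (M * A_seminorm A x)" using M by (intro mult_left_mono) auto
    finally show ?thesis .
  qed
  then show ?thesis unfolding A_bounded_def by (metis mult.assoc)
qed

lemma A_bounded_id: "A_bounded (\<lambda>x. x)"
  unfolding A_bounded_def by (intro exI[of _ 1]) simp

lemma A_norm_upper:
  assumes "A_bounded T"
  shows "A_norm A T \<ge> 0" "A_seminorm A x = 1 \<Longrightarrow> A_seminorm A (T x) \<le> A_norm A T"
proof -
  obtain L where L: "\<And>x. A_seminorm A (T x) \<le> L * A_seminorm A x"
    using assms unfolding A_bounded_def by blast
  have "A_seminorm A (T x) \<le> L" if "A_seminorm A x = 1" for x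
    using L[of x] that by simp
  then have bdd: "bdd_above (insert 0 {A_seminorm A (T x) | x. A_seminorm A x = 1})"
    by (intro bdd_aboveI[of _ "max 0 L"]) (auto intro: max.coboundedI2)
  show "A_norm A T \<ge> 0"
    unfolding A_norm_def by (rule cSup_upper[OF _ bdd]) simp
  show "A_seminorm A x = 1 \<Longrightarrow> A_seminorm A (T x) \<le> A_norm A T"
    unfolding A_norm_def by (rule cSup_upper[OF _ bdd]) blast
qed

lemma A_numerical_radius_upper:
  assumes "A_bounded T"
  shows "A_numerical_radius A T \<ge> 0"
    "A_seminorm A x = 1 \<Longrightarrow> cmod (A_inner A (T x) x) \<le> A_numerical_radius A T"
proof -
  obtain L where L: "\<And>x. A_seminorm A (T x) \<le> L * A_seminorm A x"
    using assms unfolding A_bounded_def by blast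
  have "cmod (A_inner A (T x) x) \<le> L" if "A_seminorm A x = 1" for x
    using A_inner_Cauchy_Schwarz[of "T x" x] L[of x] that by simp
  then have bdd: "bdd_above (insert 0 {cmod (A_inner A (T x) x) | x. A_seminorm A x = 1})"
    by (intro bdd_aboveI[of _ "max 0 L"]) (auto intro: max.coboundedI2)
  show "A_numerical_radius A T \<ge> 0"
    unfolding A_numerical_radius_def by (rule cSup_upper[OF _ bdd]) simp
  show "A_seminorm A x = 1 \<Longrightarrow> cmod (A_inner A (T x) x) \<le> A_numerical_radius A T"
    unfolding A_numerical_radius_def by (rule cSup_upper[OF _ bdd]) blast
qed

end

section \<open>Existence of the distinguished adjoint\<close>

lemma subspace_closure:
  fixes S :: "'a::real_normed_vector set"
  assumes "subspace S"
  shows "subspace (closure S)"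
proof (rule subspaceI)
  show "0 \<in> closure S" using closure_subset subspace_0[OF assms] by blast
next
  fix x y assume "x \<in> closure S" "y \<in> closure S"
  then obtain a b where "\<And>n. a n \<in> S" "a \<longlonglongrightarrow> x" "\<And>n. b n \<in> S" "b \<longlonglongrightarrow> y"
    unfolding closure_sequential by blast
  then show "x + y \<in> closure S"
    unfolding closure_sequential
    by (intro exI[of _ "\<lambda>n. a n + b n"]) (auto intro: subspace_add[OF assms] tendsto_add)
next
  fix x and c :: real assume "x \<in> closure S"
  then obtain a where "\<And>n. a n \<in> S" "a \<longlonglongrightarrow> x"
    unfolding closure_sequential by blast
  then show "c *\<^sub>R x \<in> closure S"
    unfolding closure_sequential
    by (intro exI[of _ "\<lambda>n. c *\<^sub>R a n"])
      (auto intro: subspace_scale[OF assms] tendsto_scaleR[OF tendsto_const])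
qed

locale positive_hilbert_operator = positive_operator A for A :: "'a::chilbert_space \<Rightarrow> 'a"
begin

lemma subspace_closure_range: "subspace (closure (range A))"
  by (intro subspace_closure subspace_UNIV linear_subspace_image A.linear_axioms)

text \<open>By symmetry, the kernel of \<open>A\<close> is the orthogonal complement of its range. A vector in the
  kernel and in the closure of the range is thus orthogonal to itself, and projecting onto that
  closure does not change the image under \<open>A\<close>.\<close>

lemma A_inj_on_closure_range:
  assumes "A u = A v" "u \<in> closure (range A)" "v \<in> closure (range A)"
  shows "u = v"
proof -
  have "A (u - v) = 0" using assms(1) by (simp add: A.diff)
  then have "inner (u - v) y = 0" if "y \<in> range A" for y
    using that by (auto simp flip: A_symmetric_inner)
  moreover have "closed {y. inner (u - v) y = 0}"
    by (intro closed_Collect_eq continuous_intros)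
  ultimately have "closure (range A) \<subseteq> {y. inner (u - v) y = 0}"
    by (intro closure_minimal) auto
  moreover have "u - v \<in> closure (range A)"
    using assms subspace_closure_range by (simp add: subspace_diff)
  ultimately show ?thesis by auto
qed

lemma A_preimage_in_closure_range: obtains u where "A u = A w" "u \<in> closure (range A)"
proof -
  obtain u where u: "u \<in> closure (range A)"
    and orth: "\<And>y. y \<in> closure (range A) \<Longrightarrow> inner (w - u) y = 0"
    using orthogonal_projection_exists[OF subspace_closure_range closed_closure, of w] by auto
  have "inner x (A (w - u)) = inner x 0" for x
  proof -
    have "A x \<in> closure (range A)" using closure_subset[of "range A"] by auto
    then show ?thesis
      using orth[of "A x"] inner_commute[of "w - u" "A x"] A_symmetric_inner[of x "w - u"] by simp
  qed
  then have "A (w - u) = 0" by (metis vector_eq_ldot)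
  then show thesis using u by (intro that[of u]) (auto simp: A.diff)
qed

text \<open>The solution of \<open>A u = T\<^sup>* (A x)\<close> in the closure of the range of \<open>A\<close> depends linearly
  on \<open>x\<close> by uniqueness; the equation and the constraint survive limits, so the closed graph
  theorem makes it bounded.\<close>

lemma A_sharp_exists:
  assumes T: "T \<in> A_adjointable A"
  obtains X where "bounded_clinear X" "A \<circ> X = cadjoint T \<circ> A" "range X \<subseteq> closure (range A)"
proof -
  have bT: "bounded_clinear T" and sub: "range (cadjoint T \<circ> A) \<subseteq> range A"
    using T by (auto simp: A_adjointable_def)
  note adj = cinner_cadjoint[OF bT]
  have "\<exists>u. A u = cadjoint T (A x) \<and> u \<in> closure (range A)" for x
  proof -
    obtain w where "cadjoint T (A x) = A w" using sub by fastforce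
    then show ?thesis using A_preimage_in_closure_range[of w] by metis
  qed
  then obtain X where AX: "\<And>x. A (X x) = cadjoint T (A x)"
    and cl: "\<And>x. X x \<in> closure (range A)" by metis
  have AX_inner: "cinner z (A (X x)) = cinner (T z) (A x)" for x z
    by (simp add: AX adj)
  have AX_inner_real: "inner z (A (X x)) = inner (T z) (A x)" for x z
    by (simp only: AX_inner flip: Re_cinner)
  have closure_scaleC: "c *\<^sub>C u \<in> closure (range A)" if u: "u \<in> closure (range A)" for c u
  proof -
    have "bounded_linear (\<lambda>u::'a. c *\<^sub>C u)"
    proof (rule bounded_linear_intro[where K = "cmod c"])
      show "c *\<^sub>C (r *\<^sub>R x) = r *\<^sub>R (c *\<^sub>C x)" for r and x :: 'a
        by (simp add: scaleC_scaleC mult.commute flip: scaleC_of_real)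
      show "norm (c *\<^sub>C x) \<le> norm x * cmod c" for x :: 'a
      proof (rule power2_le_imp_le)
        have "cinner (c *\<^sub>C x) (c *\<^sub>C x) = of_real ((cmod c)\<^sup>2) * cinner x x"
          by (simp only: cinner_scaleC_left cinner_scaleC_right complex_norm_square mult_ac)
        then have "(norm (c *\<^sub>C x))\<^sup>2 = (norm x * cmod c)\<^sup>2"
          by (simp add: power2_norm_eq_inner power_mult_distrib mult.commute flip: Re_cinner)
        then show "(norm (c *\<^sub>C x))\<^sup>2 \<le> (norm x * cmod c)\<^sup>2" by simp
      qed simp
    qed (simp add: scaleC_add_right)
    then have "(\<lambda>u. c *\<^sub>C u) ` closure (range A) \<subseteq> closure ((\<lambda>u. c *\<^sub>C u) ` range A)"
      by (rule closure_bounded_linear_image_subset)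
    moreover have "(\<lambda>u. c *\<^sub>C u) ` range A \<subseteq> range A"
      by (auto simp flip: A_scaleC)
    ultimately show ?thesis using u closure_mono by blast
  qed
  have add: "X (x + y) = X x + X y" for x y
  proof (rule A_inj_on_closure_range)
    show "A (X (x + y)) = A (X x + X y)"
      by (rule cinner_right_eqI)
        (simp add: AX_inner A.add cinner_add_right)
  qed (use cl subspace_add[OF subspace_closure_range] in auto)
  have scaleC: "X (c *\<^sub>C x) = c *\<^sub>C X x" for c x
  proof (rule A_inj_on_closure_range)
    show "A (X (c *\<^sub>C x)) = A (c *\<^sub>C X x)"
      by (rule cinner_right_eqI)
        (simp add: AX_inner A_scaleC cinner_scaleC_right)
  qed (use cl closure_scaleC in auto)
  have scaleR: "X (r *\<^sub>R x) = r *\<^sub>R X x" for r x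
    by (metis scaleC scaleC_of_real)
  have "linear X" by (intro linearI add scaleR)
  then have "bounded_linear X"
  proof (rule closed_graph_imp_bounded_linear)
    fix Y :: "nat \<Rightarrow> 'a" and x y
    assume Y: "Y \<longlonglongrightarrow> x" and XY: "(\<lambda>n. X (Y n)) \<longlonglongrightarrow> y"
    show "X x = y"
    proof (rule A_inj_on_closure_range)
      show "y \<in> closure (range A)"
        using closed_sequentially[OF closed_closure cl XY] .
      have "inner z (A (X x)) = inner z (A y)" for z
      proof (rule LIMSEQ_unique)
        show "(\<lambda>n. inner z (A (X (Y n)))) \<longlonglongrightarrow> inner z (A y)"
          by (intro tendsto_intros A.tendsto XY)
        have "(\<lambda>n. inner (T z) (A (Y n))) \<longlonglongrightarrow> inner (T z) (A x)"
          by (intro tendsto_intros A.tendsto Y)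
        then show "(\<lambda>n. inner z (A (X (Y n)))) \<longlonglongrightarrow> inner z (A (X x))"
          by (simp only: AX_inner_real)
      qed
      then show "A (X x) = A y" by (metis vector_eq_ldot)
    qed (rule cl)
  qed
  then show thesis
    using scaleC cl by (intro that[of X]) (auto simp: bounded_clinear_def AX)
qed

lemma A_sharp:
  assumes T: "T \<in> A_adjointable A"
  shows "bounded_clinear (A_sharp A T)" "A \<circ> A_sharp A T = cadjoint T \<circ> A"
proof -
  obtain X where X: "bounded_clinear X" "A \<circ> X = cadjoint T \<circ> A" "range X \<subseteq> closure (range A)"
    using A_sharp_exists[OF T] by blast
  have "A_sharp A T = X"
    unfolding A_sharp_def
  proof (rule the_equality)
    fix Y assume Y: "bounded_clinear Y \<and> A \<circ> Y = cadjoint T \<circ> A \<and> range Y \<subseteq> closure (range A)"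
    show "Y = X"
    proof
      fix x
      have "A (Y x) = A (X x)" using X Y by (metis comp_apply)
      then show "Y x = X x" using X Y A_inj_on_closure_range by blast
    qed
  qed (use X in auto)
  with X show "bounded_clinear (A_sharp A T)" "A \<circ> A_sharp A T = cadjoint T \<circ> A" by auto
qed

lemma A_inner_A_sharp:
  assumes T: "T \<in> A_adjointable A"
  shows "A_inner A (T x) y = A_inner A x (A_sharp A T y)"
proof -
  have "cinner (T x) (A y) = cinner x (A (A_sharp A T y))"
    using A_sharp(2)[OF T] cinner_cadjoint T unfolding A_adjointable_def
    by (metis (mono_tags, lifting) comp_apply mem_Collect_eq)
  then show ?thesis by (simp add: A_inner_def A_symmetric)
qed

lemma A_bounded_A_adjointable:
  assumes T: "T \<in> A_adjointable A"
  shows "A_bounded T" "A_bounded (A_sharp A T)"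
  using A_bounded_if_adjoint_pair[of T "A_sharp A T"] A_inner_A_sharp[OF T] A_sharp(1)[OF T] T
  by (auto simp: A_adjointable_def bounded_clinear_def)

end
section \<open>Two-by-two operator matrices\<close>

abbreviation (input) diag_op :: "('a::complex_inner \<Rightarrow> 'a) \<Rightarrow> 'a \<times> 'a \<Rightarrow> 'a \<times> 'a"
  where "diag_op A \<equiv> block_op A (\<lambda>_. 0) (\<lambda>_. 0) A"

context positive_operator
begin

lemma A_inner_block_op: "A_inner (diag_op A) z w = A_inner A (fst z) (fst w) + A_inner A (snd z) (snd w)"
  by (simp add: A_inner_def block_op_def cinner_prod_def split_beta)

lemma A_seminorm_block_op: "(A_seminorm (diag_op A) z)\<^sup>2 = (A_seminorm A (fst z))\<^sup>2 + (A_seminorm A (snd z))\<^sup>2"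
  unfolding A_seminorm_power2 by (simp add: A_seminorm_def A_inner_block_op A_inner_self)

lemma positive_operator_block_op: "positive_operator (diag_op A)"
proof
  have eq: "diag_op A = (\<lambda>z. (A (fst z), A (snd z)))"
    by (simp add: block_op_def fun_eq_iff split_beta)
  have "bounded_linear (diag_op A)"
    unfolding eq
    by (intro bounded_linear_Pair bounded_linear_compose[OF bounded_linear_A] bounded_linear_fst
        bounded_linear_snd)
  moreover have "diag_op A (c *\<^sub>C z) = c *\<^sub>C diag_op A z" for c z
    by (simp add: eq scaleC_prod_def A_scaleC)
  moreover have "cinner (diag_op A z) z \<in> \<real>\<^sub>\<ge>\<^sub>0" for z
    using A_inner_block_op[of z z] by (simp add: complex_nonneg_Reals_iff A_inner_self flip: A_inner_def)
  ultimately show "positive_op (diag_op A)"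
    by (simp add: positive_op_def bounded_clinear_def)
qed

end

context positive_hilbert_operator
begin

lemma A_bounded_id_plus_row_products:
  assumes "P \<in> A_adjointable A" and "Q \<in> A_adjointable A"
  shows "A_bounded (\<lambda>x. x + P (A_sharp A P x) + Q (A_sharp A Q x))"
  using assms
  by (intro A_bounded_add[OF A_bounded_add[OF A_bounded_id A_bounded_compose] A_bounded_compose]
      A_bounded_A_adjointable)

text \<open>One row contributes to the form the product \<open>\<langle>E, z\<rangle> \<langle>z, v\<rangle>\<close> with \<open>z = (x, y)\<close>,
  \<open>E = (x / \<parallel>x\<parallel>, 0)\<close> and \<open>v = (P\<^sup>\<sharp>, Q\<^sup>\<sharp>)\<close> applied to \<open>x / \<parallel>x\<parallel>\<close>, so Buzano's inequality applies to
  the unit vector \<open>z\<close>. The square \<open>(\<parallel>v\<parallel> - 1)\<^sup>2 \<ge> 0\<close> turns \<open>\<parallel>v\<parallel>\<close> into the quadratic form of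
  \<open>I + P P\<^sup>\<sharp> + Q Q\<^sup>\<sharp>\<close>.\<close>

lemma block_row_bound:
  assumes P: "P \<in> A_adjointable A" and Q: "Q \<in> A_adjointable A"
    and xy: "(A_seminorm A x)\<^sup>2 + (A_seminorm A y)\<^sup>2 = 1"
  shows "cmod (A_inner A (P x + Q y) x)
    \<le> 1/2 * A_numerical_radius A P
      + 1/4 * A_norm A (\<lambda>x. x + P (A_sharp A P x) + Q (A_sharp A Q x))"
proof -
  interpret AA: positive_operator "diag_op A" by (rule positive_operator_block_op)
  define N where "N = (\<lambda>x. x + P (A_sharp A P x) + Q (A_sharp A Q x))"
  note bP = A_bounded_A_adjointable[OF P]
  have bN: "A_bounded N"
    unfolding N_def by (rule A_bounded_id_plus_row_products[OF P Q])
  show ?thesis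
  proof (cases "A_seminorm A x = 0")
    case True
    then have "cmod (A_inner A (P x + Q y) x) = 0"
      using A_inner_Cauchy_Schwarz[of "P x + Q y" x] by simp
    then show ?thesis
      using A_norm_upper(1)[OF bN] A_numerical_radius_upper(1)[OF bP(1)] by (simp add: N_def)
  next
    case False
    define s where "s = A_seminorm A x"
    have s: "s > 0" using False A_seminorm_nonneg[of x] by (simp add: s_def)
    define e where "e = (1/s) *\<^sub>R x"
    have e: "A_seminorm A e = 1" using s by (simp add: e_def A_seminorm_scaleR flip: s_def)
    have x: "x = s *\<^sub>R e" using s by (simp add: e_def)
    define v where "v = (A_sharp A P e, A_sharp A Q e)"
    define E where "E = (e, 0 :: 'a)"
    have zero: "A_inner A 0 w = 0" "A_inner A w 0 = 0" for w
      by (simp_all add: A_inner_def A.zero cinner_zero_left cinner_zero_right)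
    have E: "A_seminorm (diag_op A) E = 1"
      using e by (simp add: E_def A_seminorm_def A_inner_block_op zero)
    have xy1: "A_seminorm (diag_op A) (x, y) = 1"
      using A_seminorm_block_op[of "(x, y)"] xy AA.A_seminorm_nonneg[of "(x, y)"]
      by (simp add: power2_eq_1_iff)
    have "A_inner A (P x + Q y) (s *\<^sub>R e) = A_inner (diag_op A) (x, y) v * of_real s"
      by (simp add: A_inner_scaleR_right A_inner_add_left A_inner_block_op v_def
          A_inner_A_sharp[OF P] A_inner_A_sharp[OF Q] algebra_simps)
    then have "A_inner A (P x + Q y) x = A_inner (diag_op A) (x, y) v * of_real s"
      by (simp only: x[symmetric])
    moreover have "A_inner (diag_op A) E (x, y) = of_real s"
      using A_inner_self_eq[of e] e
      by (simp add: E_def A_inner_block_op zero) (simp add: x A_inner_scaleR_right)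
    ultimately have "cmod (A_inner A (P x + Q y) x)
        = cmod (A_inner (diag_op A) E (x, y) * A_inner (diag_op A) (x, y) v)"
      by (simp add: mult.commute)
    also have "\<dots> \<le> 1/2 * (cmod (A_inner (diag_op A) E v) + A_seminorm (diag_op A) E * A_seminorm (diag_op A) v)"
      by (rule AA.Buzano_inequality[OF xy1])
    also have "A_inner (diag_op A) E v = A_inner A (P e) e"
      by (simp add: E_def v_def A_inner_block_op zero A_inner_A_sharp[OF P])
    also have "cmod (A_inner A (P e) e) \<le> A_numerical_radius A P"
      by (rule A_numerical_radius_upper(2)[OF bP(1) e])
    also have "A_seminorm (diag_op A) E * A_seminorm (diag_op A) v \<le> 1/2 * A_norm A N"
    proof -
      have "A_inner A (N e) e = of_real (1 + (A_seminorm (diag_op A) v)\<^sup>2)"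
        using A_inner_self_eq[of e] e
        by (simp add: N_def A_inner_add_left A_inner_A_sharp[OF P] A_inner_A_sharp[OF Q]
            A_seminorm_block_op v_def A_inner_self_eq)
      then have "1 + (A_seminorm (diag_op A) v)\<^sup>2 = Re (A_inner A (N e) e)" by simp
      also have "\<dots> \<le> A_norm A N"
        using Re_A_inner_le[of "N e" e] A_norm_upper(2)[OF bN e] e by simp
      finally have "1 + (A_seminorm (diag_op A) v)\<^sup>2 \<le> A_norm A N" .
      moreover have "0 \<le> (A_seminorm (diag_op A) v - 1)\<^sup>2" by simp
      ultimately show ?thesis by (simp add: E power2_diff)
    qed
    finally show ?thesis by (simp add: N_def)
  qed
qed

end

theorem theorem2p2:
  fixes A P Q R S :: "'a::chilbert_space \<Rightarrow> 'a"
  assumes "positive_op A"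
    and "P \<in> A_adjointable A" and "Q \<in> A_adjointable A"
    and "R \<in> A_adjointable A" and "S \<in> A_adjointable A"
  shows "A_numerical_radius (block_op A (\<lambda>_. 0) (\<lambda>_. 0) A) (block_op P Q R S)
    \<le> 1 / 2 * (A_numerical_radius A P + A_numerical_radius A S)
      + 1 / 4 * (A_norm A (\<lambda>x. x + P (A_sharp A P x) + Q (A_sharp A Q x))
                + A_norm A (\<lambda>x. x + R (A_sharp A R x) + S (A_sharp A S x)))"
    (is "_ \<le> ?B")
proof -
  interpret positive_hilbert_operator A
    by (intro positive_hilbert_operator.intro positive_operator.intro assms)
  have "0 \<le> ?B"
    using assms
    by (intro add_nonneg_nonneg mult_nonneg_nonneg A_norm_upper A_numerical_radius_upper
        A_bounded_id_plus_row_products A_bounded_A_adjointable) auto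
  moreover have "cmod (A_inner (diag_op A) (block_op P Q R S z) z) \<le> ?B" if z: "A_seminorm (diag_op A) z = 1" for z
  proof -
    obtain x y where xy: "z = (x, y)" by (cases z)
    have sum: "(A_seminorm A x)\<^sup>2 + (A_seminorm A y)\<^sup>2 = 1"
      using A_seminorm_block_op[of z] z by (simp add: xy)
    \<comment> \<open>The second row is a first row after exchanging the coordinates.\<close>
    have swap: "(\<lambda>x. x + S (A_sharp A S x) + R (A_sharp A R x))
        = (\<lambda>x. x + R (A_sharp A R x) + S (A_sharp A S x))"
      by (simp add: add_ac)
    have "A_inner (diag_op A) (block_op P Q R S z) z = A_inner A (P x + Q y) x + A_inner A (S y + R x) y"
      unfolding A_inner_block_op by (simp add: xy block_op_def add.commute)
    then have "cmod (A_inner (diag_op A) (block_op P Q R S z) z)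
        \<le> cmod (A_inner A (P x + Q y) x) + cmod (A_inner A (S y + R x) y)"
      by (simp add: norm_triangle_ineq)
    also have "\<dots> \<le> ?B"
      using block_row_bound[OF assms(2,3) sum] block_row_bound[OF assms(5,4), of y x] sum
      by (simp add: swap algebra_simps)
    finally show ?thesis .
  qed
  ultimately show ?thesis
    unfolding A_numerical_radius_def[of "diag_op A"] by (intro cSup_least) auto
qed

end
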